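(* Let $G(\theta,\cdot)$ be Borel measurable for every $\theta\in\Theta$, and assume condition (H): there are $\beta\in\,]0,1]$ and a square $\mathbb{P}^{Z}$-integrable strictly positive mapping $C:\mathbb{R}^{d}\to\,]0,\infty[$ such that $$|G(\theta,z)-G(\vartheta,z)|\le C(z)\,d_{m,2}(\theta,\vartheta)^{\beta}\quad\text{for all } z\in\mathbb{R}^{d},\ \theta,\vartheta\in\Theta.$$ Let $\Delta(\Theta)$ be the diameter of $\Theta$ with respect to $d_{m,2}$. (i) If $\sup_{\theta\in\Theta}|G(\theta,\cdot)|$ is bounded from above by some strictly positive $\mathbb{P}^{Z}$-integrable mapping, then the following requirement (A 3) is met: there exist an at most countable subset $\overline{\Theta}\subseteq\Theta$ and $(\mathbb{P}^{Z})^{n}$-null sets $N_{n}$ ($n\in\mathbb{N}$) such that $$\inf_{\vartheta\in\overline{\Theta}}\big|\mathbb{E}[G(\vartheta,Z_{1})]-\mathbb{E}[G(\theta,Z_{1})]\big|=\inf_{\vartheta\in\overline{\Theta}}\max_{j\in\{1,\dots,n\}}|G(\theta,z_{j})-G(\vartheta,z_{j})|=0$$ for all $n\in\mathbb{N}$, $\theta\in\Theta$, $(z_{1},\dots,z_{n})\in\mathbb{R}^{dn}\setminus N_{n}$. (ii) If $\Delta(\Theta)>0$ and $G(\overline{\theta},\cdot)$ is square $\mathbb{P}^{Z}$-integrable for some $\overline{\theta}\in\Theta$, then the mapping $\xi:=C\,\Delta(\Theta)^{\beta}+|G(\overline{\theta},\cdot)|$ is square $\mathbb{P}^{Z}$-integrable,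 it is strictly positive with $\sup_{\theta\in\Theta}|G(\theta,z)|\le\xi(z)$ for all $z\in\mathbb{R}^{d}$, and $$\sup_{\mathbb{Q}\in\mathcal{M}_{\mathrm{fin}}}N\big(\varepsilon\|\xi\|_{\mathbb{Q},2},\mathbb{F}^{\Theta},L^{2}(\mathbb{Q})\big)\le\frac{(8+\varepsilon^{1/\beta})^{m}}{\varepsilon^{m/\beta}}\quad\text{for } \varepsilon>0.$$ In particular $$J(\mathbb{F}^{\Theta},\xi,\delta)\le2\delta\sqrt{(3m+1)\ln(2)+\frac{m}{\beta}\ln(2/\delta)}\quad\text{for }\delta\in\,]0,1/2].$$
   Context: Let $m,d\in\mathbb{N}$, let $\Theta\subseteq\mathbb{R}^{m}$ be nonempty and compact, and let $(Z_{j})_{j\in\mathbb{N}}$ be i.i.d. $d$-dimensional random vectors on an atomless complete probability space $(\Omega,\mathcal{F},\mathbb{P})$ with common distribution $\mathbb{P}^{Z}$. Let $G:\Theta\times\mathbb{R}^{d}\to\mathbb{R}$ and $\mathbb{F}^{\Theta}:=\{G(\theta,\cdot)\mid\theta\in\Theta\}$. $d_{m,2}$ is the Euclidean metric on $\mathbb{R}^{m}$. For a probability measure $\mathbb{Q}$ on $\mathcal{B}(\mathbb{R}^{d})$, $\|\cdot\|_{\mathbb{Q},2}$ is the $L^{2}(\mathbb{Q})$-norm. For a nonempty set $\mathbb{F}$ of Borel measurable functions $\mathbb{R}^{d}\to\mathbb{R}$, $N(\eta,\mathbb{F},L^{2}(\mathbb{Q}))$ is the minimal number of closed $L^{2}(\mathbb{Q})$-balls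 of radius $\eta>0$ with centers in $\mathbb{F}$ needed to cover $\mathbb{F}$ ($\infty$ if there is no finite cover). $\mathcal{M}_{\mathrm{fin}}$ is the set of probability measures on $\mathcal{B}(\mathbb{R}^{d})$ with finite support. For a Borel measurable strictly positive $C_{\mathbb{F}}$ with $\sup_{h\in\mathbb{F}}|h|\le C_{\mathbb{F}}$ (positive envelope), $$J(\mathbb{F},C_{\mathbb{F}},\delta):=\int_{0}^{\delta}\sup_{\mathbb{Q}\in\mathcal{M}_{\mathrm{fin}}}\sqrt{\ln\big(2N(\varepsilon\|C_{\mathbb{F}}\|_{\mathbb{Q},2},\mathbb{F},L^{2}(\mathbb{Q}))\big)}\,d\varepsilon .$$ *)

theory Defs
  imports "HOL-Probability.Probability"
begin

definition atomless :: "'a measure \<Rightarrow> bool" where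
  "atomless M \<longleftrightarrow>
    (\<forall>A\<in>sets M. 0 < emeasure M A \<longrightarrow>
      (\<exists>B\<in>sets M. B \<subseteq> A \<and> 0 < emeasure M B \<and> emeasure M B < emeasure M A))"

definition square_integrable :: "'a measure \<Rightarrow> ('a \<Rightarrow> real) \<Rightarrow> bool" where
  "square_integrable M f \<longleftrightarrow> f \<in> borel_measurable M \<and> integrable M (\<lambda>x. (f x)\<^sup>2)"

text \<open>Only meaningful for square integrable functions: the Bochner integral of a
  non-integrable function is 0.\<close>

definition L2_norm :: "'a measure \<Rightarrow> ('a \<Rightarrow> real) \<Rightarrow> real" where
  "L2_norm Q f = sqrt (\<integral>x. (f x)\<^sup>2 \<partial>Q)"

definition L2_cball :: "'a measure \<Rightarrow> ('a \<Rightarrow> real) \<Rightarrow> real \<Rightarrow> ('a \<Rightarrow> real) set" where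
  "L2_cball Q g \<eta> =
    {f. square_integrable Q (\<lambda>x. f x - g x) \<and> L2_norm Q (\<lambda>x. f x - g x) \<le> \<eta>}"

text \<open>In \<^typ>\<open>enat\<close> the infimum of the empty set is \<open>\<infinity>\<close>, which is the value if there is no
  finite cover.\<close>

definition covering_number :: "real \<Rightarrow> ('a \<Rightarrow> real) set \<Rightarrow> 'a measure \<Rightarrow> enat" where
  "covering_number \<eta> F Q =
    (INF S\<in>{S. finite S \<and> S \<subseteq> F \<and> F \<subseteq> (\<Union>g\<in>S. L2_cball Q g \<eta>)}. enat (card S))"

definition finsupp_prob :: "'a::topological_space measure set" where
  "finsupp_prob =
    {Q. prob_space Q \<and> sets Q = sets borel \<and> (\<exists>S\<in>sets borel. finite S \<and> emeasure Q S = 1)}"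

definition positive_envelope ::
    "('a::topological_space \<Rightarrow> real) set \<Rightarrow> ('a \<Rightarrow> real) \<Rightarrow> bool" where
  "positive_envelope F C \<longleftrightarrow>
    C \<in> borel_measurable borel \<and> (\<forall>z. 0 < C z) \<and>
    (\<forall>z. (SUP h\<in>F. ereal \<bar>h z\<bar>) \<le> ereal (C z))"

fun sqrt_ln_twice :: "enat \<Rightarrow> ennreal" where
  "sqrt_ln_twice (enat k) = ennreal (sqrt (ln (2 * real k)))"
| "sqrt_ln_twice \<infinity> = \<infinity>"

definition uniform_entropy_integral ::
    "('a::topological_space \<Rightarrow> real) set \<Rightarrow> ('a \<Rightarrow> real) \<Rightarrow> real \<Rightarrow> ennreal" where
  "uniform_entropy_integral F C \<delta> =
    (\<integral>\<^sup>+\<epsilon>\<in>{0<..\<delta>}.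
      (SUP Q\<in>finsupp_prob. sqrt_ln_twice (covering_number (\<epsilon> * L2_norm Q C) F Q)) \<partial>lborel)"

definition condition_H ::
    "'b measure \<Rightarrow> 'a::metric_space set \<Rightarrow> ('a \<Rightarrow> 'b \<Rightarrow> real) \<Rightarrow> real \<Rightarrow> ('b \<Rightarrow> real) \<Rightarrow> bool" where
  "condition_H PZ \<Theta> G \<beta> C \<longleftrightarrow>
    0 < \<beta> \<and> \<beta> \<le> 1 \<and> square_integrable PZ C \<and> (\<forall>z. 0 < C z) \<and>
    (\<forall>z. \<forall>\<theta>\<in>\<Theta>. \<forall>\<theta>'\<in>\<Theta>. \<bar>G \<theta> z - G \<theta>' z\<bar> \<le> C z * dist \<theta> \<theta>' powr \<beta>)"

text \<open>The \<open>n\<close>-tuples \<open>(z\<^sub>1, \<dots>, z\<^sub>n)\<close> are the points of the product space over the index set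
  \<open>{1..n}\<close>. Nonemptiness of \<open>T\<close> is part of the infima being 0, since the infimum of
  the empty set is \<open>\<infinity>\<close> by convention but unspecified in \<^typ>\<open>real\<close>.\<close>

definition requirement_A3 ::
    "'w measure \<Rightarrow> (nat \<Rightarrow> 'w \<Rightarrow> 'b) \<Rightarrow> 'b measure \<Rightarrow> 'a set \<Rightarrow> ('a \<Rightarrow> 'b \<Rightarrow> real) \<Rightarrow> bool" where
  "requirement_A3 M Z PZ \<Theta> G \<longleftrightarrow>
    (\<exists>T. \<exists>N :: nat \<Rightarrow> (nat \<Rightarrow> 'b) set. T \<subseteq> \<Theta> \<and> countable T \<and> T \<noteq> {} \<and>
      (\<forall>n\<ge>1. N n \<in> null_sets (Pi\<^sub>M {1..n} (\<lambda>_. PZ))) \<and>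
      (\<forall>n\<ge>1. \<forall>\<theta>\<in>\<Theta>. \<forall>z\<in>space (Pi\<^sub>M {1..n} (\<lambda>_. PZ)) - N n.
        (INF \<theta>'\<in>T. \<bar>(\<integral>\<omega>. G \<theta>' (Z 1 \<omega>) \<partial>M) - (\<integral>\<omega>. G \<theta> (Z 1 \<omega>) \<partial>M)\<bar>) = 0 \<and>
        (INF \<theta>'\<in>T. Max ((\<lambda>j. \<bar>G \<theta> (z j) - G \<theta>' (z j)\<bar>) ` {1..n})) = 0))"

end

(* By the Hoelder condition (H), an r-net of \<Theta> with r = \<Delta>(\<Theta>) * \<epsilon>^(1/\<beta>) gives an L2(Q)-net of
   radius \<epsilon> * \<parallel>\<xi>\<parallel>, since C * \<Delta>(\<Theta>)^\<beta> \<le> \<xi>. A maximal r-separated subset of \<Theta> is such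
   an r-net, and comparing the volumes of the disjoint balls of radius r/2 around its points
   with that of a ball of radius \<Delta>(\<Theta>) + r/2 bounds its cardinality by (1 + 2\<Delta>(\<Theta>)/r)^m.
   The entropy integral is then bounded through an explicit antiderivative. For (i), a
   countable dense subset of \<Theta> works, even with empty exceptional sets. *)

theory Submission
  imports Defs
begin

section \<open>Separated sets and nets in Euclidean space\<close>

lemma card_separated_le:
  fixes \<Theta> :: "'a::euclidean_space set"
  assumes "bounded \<Theta>" "finite T" "T \<subseteq> \<Theta>" "T \<noteq> {}" "0 < r"
    and sep: "pairwise (\<lambda>x y. r < dist x y) T"
  shows "real (card T) \<le> (1 + 2 * diameter \<Theta> / r) ^ DIM('a)"
proof -
  define \<Delta> where "\<Delta> = diameter \<Theta>"
  define v where "v = unit_ball_vol (real DIM('a))"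
  obtain t\<^sub>0 where t\<^sub>0: "t\<^sub>0 \<in> T" using assms by auto
  have \<Delta>: "dist x y \<le> \<Delta>" if "x \<in> T" "y \<in> T" for x y
    using diameter_bounded_bound[OF \<open>bounded \<Theta>\<close>] that assms unfolding \<Delta>_def by blast
  then have "0 \<le> \<Delta>" using t\<^sub>0 by force
  have "v > 0" by (simp add: v_def)
  have disj: "pairwise (\<lambda>x y. disjnt (ball x (r / 2)) (ball y (r / 2))) T"
    unfolding pairwise_def
  proof (intro ballI impI)
    fix x y assume "x \<in> T" "y \<in> T" "x \<noteq> y"
    then have "r < dist x y" using sep by (auto simp: pairwise_def)
    then show "disjnt (ball x (r / 2)) (ball y (r / 2))"
      by (intro disjoint_ballI[folded disjnt_def]) simp
  qed
  have "real (card T) * (v * (r / 2) ^ DIM('a)) = (\<Sum>x\<in>T. measure lborel (ball x (r / 2)))"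
    using \<open>0 < r\<close> by (simp add: content_ball v_def)
  also have "\<dots> = measure lborel (\<Union>x\<in>T. ball x (r / 2))"
    using disj \<open>finite T\<close> \<open>0 < r\<close>
    by (intro measure_UNION'[symmetric]) (auto intro!: fmeasurableI simp: emeasure_ball)
  also have "\<dots> \<le> measure lborel (cball t\<^sub>0 (\<Delta> + r / 2))"
  proof (rule measure_mono_fmeasurable)
    show "(\<Union>x\<in>T. ball x (r / 2)) \<subseteq> cball t\<^sub>0 (\<Delta> + r / 2)"
    proof (rule UN_least)
      fix x assume "x \<in> T"
      show "ball x (r / 2) \<subseteq> cball t\<^sub>0 (\<Delta> + r / 2)"
      proof
        fix y assume "y \<in> ball x (r / 2)"
        then show "y \<in> cball t\<^sub>0 (\<Delta> + r / 2)"
          using \<Delta>[OF t\<^sub>0 \<open>x \<in> T\<close>] dist_triangle[of t\<^sub>0 y x] by simp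
      qed
    qed
    show "(\<Union>x\<in>T. ball x (r / 2)) \<in> sets lborel" by (simp add: borel_open open_UN)
  qed (use \<open>0 \<le> \<Delta>\<close> \<open>0 < r\<close> in \<open>auto intro!: fmeasurableI simp: emeasure_cball\<close>)
  also have "\<dots> = v * (\<Delta> + r / 2) ^ DIM('a)"
    using \<open>0 \<le> \<Delta>\<close> \<open>0 < r\<close> by (simp add: content_cball v_def)
  finally have "real (card T) * (r / 2) ^ DIM('a) \<le> (\<Delta> + r / 2) ^ DIM('a)"
    using \<open>v > 0\<close> by simp
  then have "real (card T) \<le> (\<Delta> + r / 2) ^ DIM('a) / (r / 2) ^ DIM('a)"
    using \<open>0 < r\<close> by (simp add: pos_le_divide_eq)
  also have "\<dots> = ((\<Delta> + r / 2) / (r / 2)) ^ DIM('a)"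
    by (rule power_divide[symmetric])
  also have "(\<Delta> + r / 2) / (r / 2) = 1 + 2 * \<Delta> / r"
    using \<open>0 < r\<close> by (simp add: field_simps)
  finally show ?thesis by (simp add: \<Delta>_def)
qed

text \<open>Cardinality rather than inclusion is maximized: the volume bound caps the size of all
  separated subsets at once, so a largest one exists. A point of \<Theta> farther than
  \<open>r\<close> from all its members could be added to it, hence it is a net.\<close>

lemma finite_cover_cball:
  fixes \<Theta> :: "'a::euclidean_space set"
  assumes "bounded \<Theta>" "\<Theta> \<noteq> {}" "0 < r"
  obtains T where "finite T" "T \<subseteq> \<Theta>" "\<Theta> \<subseteq> (\<Union>t\<in>T. cball t r)"
    "real (card T) \<le> (1 + 2 * diameter \<Theta> / r) ^ DIM('a)"
proof -
  define P where "P T \<longleftrightarrow>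
    finite T \<and> T \<subseteq> \<Theta> \<and> T \<noteq> {} \<and> pairwise (\<lambda>x y. r < dist x y) T" for T
  have bound: "real (card T) \<le> (1 + 2 * diameter \<Theta> / r) ^ DIM('a)" if "P T" for T
    using card_separated_le[OF \<open>bounded \<Theta>\<close> _ _ _ \<open>0 < r\<close>] that unfolding P_def by blast
  obtain \<theta> where "\<theta> \<in> \<Theta>" using assms by auto
  then have "P {\<theta>}" by (simp add: P_def)
  moreover have "\<forall>T. P T \<longrightarrow> card T < nat \<lfloor>(1 + 2 * diameter \<Theta> / r) ^ DIM('a)\<rfloor> + 1"
    using bound by (auto simp: less_Suc_eq_le le_nat_floor)
  ultimately obtain T where T: "P T" and max: "\<And>S. P S \<Longrightarrow> card S \<le> card T"
    using ex_has_greatest_nat[of P "{\<theta>}" card] by blast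
  have "\<Theta> \<subseteq> (\<Union>t\<in>T. cball t r)"
  proof (rule ccontr)
    assume "\<not> ?thesis"
    then obtain x where "x \<in> \<Theta>" "x \<notin> (\<Union>t\<in>T. cball t r)" by blast
    then have x: "x \<in> \<Theta>" "\<And>t. t \<in> T \<Longrightarrow> r < dist t x" by (auto simp: not_le)
    then have "x \<notin> T" using \<open>0 < r\<close> by force
    have "P (insert x T)"
      using T x by (auto simp: P_def pairwise_insert dist_commute)
    then show False
      using max[of "insert x T"] T \<open>x \<notin> T\<close> by (simp add: P_def)
  qed
  then show thesis
    using that T bound[OF T] by (auto simp: P_def)
qed

section \<open>L2 covering numbers under the Hoelder condition\<close>

lemma covering_number_le_card:
  assumes "finite S" "S \<subseteq> F" "F \<subseteq> (\<Union>g\<in>S. L2_cball Q g \<eta>)"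
  shows "covering_number \<eta> F Q \<le> enat (card S)"
  unfolding covering_number_def using assms by (intro INF_lower) auto

text \<open>Almost everywhere the argument lies in a finite set, where \<bar>f\<bar> is at most the
  sum of its values there. This supplies the square integrability demanded by
  \<open>L2_cball\<close> and makes the Bochner integrals in \<open>L2_norm\<close> genuine rather
  than the default 0.\<close>

lemma finsupp_prob_integrable:
  fixes f :: "'a::topological_space \<Rightarrow> real"
  assumes "Q \<in> finsupp_prob" "f \<in> borel_measurable borel"
  shows "integrable Q f"
proof -
  obtain S where Q: "prob_space Q" "sets Q = sets borel"
    and S: "S \<in> sets borel" "finite S" "emeasure Q S = 1"
    using assms by (auto simp: finsupp_prob_def)
  interpret prob_space Q by fact
  have "prob S = 1" using S by (simp add: measure_def)
  then have "AE x in Q. x \<in> S" by (rule AE_prob_1)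
  then have "AE x in Q. norm (f x) \<le> (\<Sum>s\<in>S. norm (f s))"
    by (rule AE_mp) (auto intro!: member_le_sum S)
  moreover have "f \<in> borel_measurable Q"
    using assms(2) Q(2) by (simp cong: measurable_cong_sets)
  ultimately show ?thesis by (rule integrable_const_bound)
qed

text \<open>The base 1 + 2/x with x = \<open>\<epsilon> powr (1 / \<beta>)\<close> is kept because
  it yields both later bounds: it is at most (8 + x)/x for every x > 0, and at most 8/x once x \<le>
  1.\<close>

lemma hoelder_covering_number:
  fixes \<Theta> :: "'a::euclidean_space set" and G :: "'a \<Rightarrow> 'b::topological_space \<Rightarrow> real"
  assumes Q: "Q \<in> finsupp_prob"
    and \<Theta>: "bounded \<Theta>" "\<Theta> \<noteq> {}" "0 < diameter \<Theta>"
    and G: "\<And>\<theta>. \<theta> \<in> \<Theta> \<Longrightarrow> G \<theta> \<in> borel_measurable borel"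
    and \<xi>: "\<xi> \<in> borel_measurable borel" "\<And>z. C z * diameter \<Theta> powr \<beta> \<le> \<xi> z"
    and C: "\<And>z. 0 \<le> C z"
    and hoelder: "\<And>z \<theta> \<theta>'. \<theta> \<in> \<Theta> \<Longrightarrow> \<theta>' \<in> \<Theta> \<Longrightarrow>
      \<bar>G \<theta> z - G \<theta>' z\<bar> \<le> C z * dist \<theta> \<theta>' powr \<beta>"
    and "0 < \<beta>" "0 < \<epsilon>"
  obtains k where "covering_number (\<epsilon> * L2_norm Q \<xi>) (G ` \<Theta>) Q = enat k"
    "real k \<le> (1 + 2 / \<epsilon> powr (1 / \<beta>)) ^ DIM('a)"
proof -
  \<comment> \<open>Chosen so that \<open>r powr \<beta>\<close> is \<epsilon> times the factor
    \<open>diameter \<Theta> powr \<beta>\<close> occurring in the lower bound for \<xi>.\<close>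
  define r where "r = diameter \<Theta> * \<epsilon> powr (1 / \<beta>)"
  have "0 < r" using assms by (simp add: r_def)
  have r: "r powr \<beta> = diameter \<Theta> powr \<beta> * \<epsilon>"
    using assms by (simp add: r_def powr_mult powr_powr)
  obtain T where T: "finite T" "T \<subseteq> \<Theta>" "\<Theta> \<subseteq> (\<Union>t\<in>T. cball t r)"
    and card: "real (card T) \<le> (1 + 2 * diameter \<Theta> / r) ^ DIM('a)"
    using finite_cover_cball[OF \<Theta>(1,2) \<open>0 < r\<close>] by blast
  have "G ` \<Theta> \<subseteq> (\<Union>g\<in>G ` T. L2_cball Q g (\<epsilon> * L2_norm Q \<xi>))"
  proof (rule image_subsetI)
    fix \<theta> assume "\<theta> \<in> \<Theta>"
    then obtain t where t: "t \<in> T" "dist t \<theta> \<le> r" using T by auto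
    define h where "h z = G \<theta> z - G t z" for z
    have h[measurable]: "h \<in> borel_measurable borel"
      unfolding h_def using G \<open>\<theta> \<in> \<Theta>\<close> t T by (intro borel_measurable_diff) auto
    have bound: "\<bar>h z\<bar> \<le> \<epsilon> * \<xi> z" for z
    proof -
      have "\<bar>h z\<bar> \<le> C z * dist \<theta> t powr \<beta>"
        unfolding h_def using hoelder \<open>\<theta> \<in> \<Theta>\<close> t T by auto
      also have "\<dots> \<le> C z * r powr \<beta>"
        using t \<open>0 < \<beta>\<close> C by (intro mult_left_mono powr_mono2) (auto simp: dist_commute)
      also have "\<dots> = \<epsilon> * (C z * diameter \<Theta> powr \<beta>)" by (simp add: r)
      also have "\<dots> \<le> \<epsilon> * \<xi> z" using \<xi>(2) \<open>0 < \<epsilon>\<close> by (intro mult_left_mono) auto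
      finally show ?thesis .
    qed
    have int: "integrable Q (\<lambda>z. (h z)\<^sup>2)" "integrable Q (\<lambda>z. (\<epsilon> * \<xi> z)\<^sup>2)"
      using \<xi>(1) by (auto intro!: finsupp_prob_integrable[OF Q])
    have "h \<in> borel_measurable Q"
      using h Q by (simp add: finsupp_prob_def cong: measurable_cong_sets)
    then have "square_integrable Q h" using int by (simp add: square_integrable_def)
    moreover have "L2_norm Q h \<le> \<epsilon> * L2_norm Q \<xi>"
    proof -
      have "(h z)\<^sup>2 \<le> (\<epsilon> * \<xi> z)\<^sup>2" for z
        using bound[of z] by (metis abs_ge_zero power2_abs power_mono)
      then have "L2_norm Q h \<le> sqrt (\<integral>z. (\<epsilon> * \<xi> z)\<^sup>2 \<partial>Q)"
        unfolding L2_norm_def by (intro real_sqrt_le_mono integral_mono int)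
      also have "\<dots> = \<epsilon> * L2_norm Q \<xi>"
        using \<open>0 < \<epsilon>\<close> by (simp add: L2_norm_def power_mult_distrib real_sqrt_mult)
      finally show ?thesis .
    qed
    ultimately show "G \<theta> \<in> (\<Union>g\<in>G ` T. L2_cball Q g (\<epsilon> * L2_norm Q \<xi>))"
      using t by (auto simp: L2_cball_def h_def[abs_def])
  qed
  then have "covering_number (\<epsilon> * L2_norm Q \<xi>) (G ` \<Theta>) Q \<le> enat (card (G ` T))"
    using T by (intro covering_number_le_card) auto
  \<comment> \<open>Different parameters may give the same function, so passing from
    \<open>T\<close> to its image can only lower the count.\<close>
  also have "\<dots> \<le> enat (card T)" using T by (simp add: card_image_le)
  finally obtain k where k: "covering_number (\<epsilon> * L2_norm Q \<xi>) (G ` \<Theta>) Q = enat k" "k \<le> card T"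
    by (metis enat_ile enat_ord_simps(1))
  \<comment> \<open>The diameter cancels because \<open>r\<close> is proportional to it; the final
    bound depends only on \<epsilon>, \<beta> and the dimension.\<close>
  have "2 * diameter \<Theta> / r = 2 / \<epsilon> powr (1 / \<beta>)"
    using \<open>0 < diameter \<Theta>\<close> by (simp add: r_def)
  with k card that show thesis by force
qed

section \<open>Infima along a dense subset\<close>

text \<open>Points of \<open>T\<close> come arbitrarily close to \<theta>, and the Hoelder bound
  tends to 0 along them. Both infima of (A 3) are instances, with different constants
  \<open>K\<close>.\<close>

lemma INF_eq_0_if_hoelder:
  fixes f :: "'a::metric_space \<Rightarrow> real"
  assumes "\<theta> \<in> closure T" "0 < \<beta>" "0 \<le> K"
    and "\<And>t. t \<in> T \<Longrightarrow> 0 \<le> f t"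
    and f: "\<And>t. t \<in> T \<Longrightarrow> f t \<le> K * dist \<theta> t powr \<beta>"
  shows "(INF t\<in>T. f t) = 0"
proof (rule cInf_eq_non_empty)
  show "f ` T \<noteq> {}" using assms(1) by auto
  show "0 \<le> x" if "x \<in> f ` T" for x using assms that by auto
  fix y assume y: "\<And>x. x \<in> f ` T \<Longrightarrow> y \<le> x"
  show "y \<le> 0"
  proof (rule field_le_epsilon)
    fix e :: real assume "0 < e"
    \<comment> \<open>Solves \<open>(K + 1) * d powr \<beta> = e\<close>; using \<open>K + 1\<close>
      instead of \<open>K\<close> avoids dividing by 0.\<close>
    define d where "d = (e / (K + 1)) powr (1 / \<beta>)"
    have "0 < d" using \<open>0 < e\<close> \<open>0 \<le> K\<close> by (simp add: d_def)
    then obtain t where t: "t \<in> T" "dist \<theta> t < d"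
      using assms(1) by (metis closure_approachable dist_commute)
    have "y \<le> f t" using y t by auto
    also have "\<dots> \<le> K * dist \<theta> t powr \<beta>" using f t by auto
    also have "\<dots> \<le> K * d powr \<beta>"
      using t \<open>0 < \<beta>\<close> \<open>0 \<le> K\<close> by (intro mult_left_mono powr_mono2) auto
    also have "d powr \<beta> = e / (K + 1)"
      using \<open>0 < e\<close> \<open>0 \<le> K\<close> \<open>0 < \<beta>\<close> by (simp add: d_def powr_powr)
    also have "K * (e / (K + 1)) \<le> 0 + e"
      using \<open>0 < e\<close> \<open>0 \<le> K\<close> by (simp add: field_simps)
    finally show "y \<le> 0 + e" .
  qed
qed

section \<open>Bounds for the entropy integral\<close>

lemma nn_integral_sqrt_ln_le:
  fixes a v \<delta> :: real
  assumes "0 \<le> a" "0 < v" "0 < \<delta>" "\<delta> \<le> 1 / 2"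
  shows "(\<integral>\<^sup>+\<epsilon>\<in>{0<..\<delta>}. ennreal (sqrt (a + v * ln (2 / \<epsilon>))) \<partial>lborel)
    \<le> ennreal (2 * \<delta> * sqrt (a + v * ln (2 / \<delta>)))"
proof -
  define g where "g \<epsilon> = sqrt (a + v * ln (2 / \<epsilon>))" for \<epsilon>
  \<comment> \<open>Here \<delta> \<le> 1/2 enters: 2/\<epsilon> \<ge> 4 > e, so the logarithm
    exceeds 1. This keeps the radicand positive and gives
    \<open>v < (g \<epsilon>)\<^sup>2\<close>.\<close>
  have ge: "v < a + v * ln (2 / \<epsilon>)" if "0 < \<epsilon>" "\<epsilon> \<le> \<delta>" for \<epsilon>
  proof -
    have "exp 1 < (4::real)" using exp_le by simp
    also have "4 \<le> 2 / \<epsilon>" using that assms by (simp add: field_simps)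
    finally have "ln (exp 1) < ln (2 / \<epsilon>)" using that by (subst ln_less_cancel_iff) auto
    then have "1 < ln (2 / \<epsilon>)" by simp
    then have "v < v * ln (2 / \<epsilon>)" using \<open>0 < v\<close> by simp
    then show ?thesis using \<open>0 \<le> a\<close> by linarith
  qed
  \<comment> \<open>\<open>h\<close> is the derivative of \<open>\<lambda>\<epsilon>. 2 * \<epsilon> * g \<epsilon>\<close>, and \<open>g \<le> h\<close> because \<open>g\<^sup>2 \<ge> v\<close>.\<close>
  define h where "h \<epsilon> = 2 * g \<epsilon> - v / g \<epsilon>" for \<epsilon>
  have g_pos: "0 < g \<epsilon>" if "0 < \<epsilon>" "\<epsilon> \<le> \<delta>" for \<epsilon>
    using ge[OF that] \<open>0 < v\<close> by (simp add: g_def)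
  have g_le_h: "g \<epsilon> \<le> h \<epsilon>" if "0 < \<epsilon>" "\<epsilon> \<le> \<delta>" for \<epsilon>
  proof -
    have "v \<le> g \<epsilon> * g \<epsilon>" using ge[OF that] \<open>0 < v\<close> by (simp add: g_def)
    then have "v / g \<epsilon> \<le> g \<epsilon>" using g_pos[OF that] by (simp add: pos_divide_le_eq)
    then show ?thesis by (simp add: h_def)
  qed
  have [measurable]: "g \<in> borel_measurable borel" "h \<in> borel_measurable borel"
    unfolding g_def h_def by measurable
  \<comment> \<open>\<open>g\<close> is unbounded at 0, so the fundamental theorem is applied away from 0.\<close>
  define A where "A n = {\<delta> / real (n + 1)..\<delta>}" for n
  have piece: "(\<integral>\<^sup>+\<epsilon>\<in>A n. ennreal (g \<epsilon>) \<partial>lborel) \<le> ennreal (2 * \<delta> * g \<delta>)" for n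
  proof -
    define b where "b = \<delta> / real (n + 1)"
    have b: "0 < b" "b \<le> \<delta>" using \<open>0 < \<delta>\<close> by (auto simp: b_def field_simps)
    have "(\<integral>\<^sup>+\<epsilon>\<in>A n. ennreal (g \<epsilon>) \<partial>lborel) \<le> (\<integral>\<^sup>+\<epsilon>. ennreal (h \<epsilon>) * indicator {b..\<delta>} \<epsilon> \<partial>lborel)"
      using g_le_h b unfolding A_def b_def[symmetric]
      by (intro nn_integral_mono) (auto split: split_indicator intro!: ennreal_leI)
    also have "\<dots> = ennreal (2 * \<delta> * g \<delta> - 2 * b * g b)"
    proof (rule nn_integral_FTC_Icc)
      fix x assume "x \<in> {b..\<delta>}"
      then have x: "0 < x" "x \<le> \<delta>" using b by auto
      show "0 \<le> h x" using g_le_h[OF x] g_pos[OF x] by simp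
      have "0 < a + v * ln (2 / x)" using ge[OF x] \<open>0 < v\<close> by simp
      then show "((\<lambda>x. 2 * x * g x) has_real_derivative h x) (at x)"
        unfolding g_def h_def using x
        by (auto intro!: derivative_eq_intros simp: field_simps power2_eq_square)
    qed (use b in auto)
    \<comment> \<open>The boundary term at \<open>b\<close> is nonnegative and is dropped. The bound
      is thus uniform in \<open>n\<close>, and no limit of the antiderivative at 0 has to be
      computed.\<close>
    also have "\<dots> \<le> ennreal (2 * \<delta> * g \<delta>)"
      using b g_pos[of b] by (intro ennreal_leI) auto
    finally show ?thesis .
  qed
  have "incseq A"
    unfolding A_def using \<open>0 < \<delta>\<close>
    by (intro incseq_SucI) (auto simp: field_simps elim!: order_trans[rotated])
  have "(\<Union>n. A n) = {0<..\<delta>}"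
  proof (intro equalityI subsetI)
    fix x assume x: "x \<in> {0<..\<delta>}"
    obtain n where "\<delta> / x < real n" using reals_Archimedean2 by blast
    then have "\<delta> / real (n + 1) \<le> x" using x by (simp add: field_simps)
    then show "x \<in> (\<Union>n. A n)" using x by (auto simp: A_def)
  next
    fix x assume "x \<in> (\<Union>n. A n)"
    then obtain n where "\<delta> / real (n + 1) \<le> x" "x \<le> \<delta>" by (auto simp: A_def)
    moreover have "0 < \<delta> / real (n + 1)" using \<open>0 < \<delta>\<close> by simp
    ultimately show "x \<in> {0<..\<delta>}" by simp
  qed
  \<comment> \<open>With \<open>g\<close> as a density, exhausting the half-open interval by the
    sets \<open>A n\<close> becomes continuity from below of a measure.\<close>
  define D where "D = density lborel (\<lambda>\<epsilon>. ennreal (g \<epsilon>))"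
  have D: "emeasure D B = (\<integral>\<^sup>+\<epsilon>\<in>B. ennreal (g \<epsilon>) \<partial>lborel)" if "B \<in> sets borel" for B
    unfolding D_def using that by (simp add: emeasure_density)
  have "(\<integral>\<^sup>+\<epsilon>\<in>{0<..\<delta>}. ennreal (g \<epsilon>) \<partial>lborel) = emeasure D (\<Union>n. A n)"
    by (simp add: D \<open>(\<Union>n. A n) = {0<..\<delta>}\<close>)
  also have "\<dots> = (SUP n. emeasure D (A n))"
  proof (intro SUP_emeasure_incseq[symmetric] \<open>incseq A\<close>)
    show "range A \<subseteq> sets D" by (auto simp: A_def D_def)
  qed
  also have "\<dots> \<le> ennreal (2 * \<delta> * g \<delta>)"
    using piece by (intro SUP_least) (simp add: D A_def)
  finally show ?thesis by (simp add: g_def)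
qed

lemma sqrt_ln_twice_le:
  assumes "real k \<le> B" "1 \<le> B"
  shows "sqrt_ln_twice (enat k) \<le> ennreal (sqrt (ln (2 * B)))"
proof (cases "k = 0")
  \<comment> \<open>Here \<open>ln 0 = 0\<close>, so \<open>sqrt_ln_twice\<close> takes the value
    0.\<close>
  case True
  then show ?thesis by simp
next
  case False
  then show ?thesis using assms by (auto intro!: ennreal_leI)
qed

lemma uniform_entropy_integral_le:
  fixes F :: "('a::topological_space \<Rightarrow> real) set"
  assumes "0 < \<beta>" "0 < m"
    and cover: "\<And>Q \<epsilon>. Q \<in> finsupp_prob \<Longrightarrow> 0 < \<epsilon> \<Longrightarrow>
      \<exists>k. covering_number (\<epsilon> * L2_norm Q \<xi>) F Q = enat k \<and> real k \<le> (1 + 2 / \<epsilon> powr (1 / \<beta>)) ^ m"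
    and "0 < \<delta>" "\<delta> \<le> 1 / 2"
  shows "uniform_entropy_integral F \<xi> \<delta>
    \<le> ennreal (2 * \<delta> * sqrt ((3 * real m + 1) * ln 2 + real m / \<beta> * ln (2 / \<delta>)))"
proof -
  have "sqrt_ln_twice (covering_number (\<epsilon> * L2_norm Q \<xi>) F Q)
      \<le> ennreal (sqrt ((3 * real m + 1) * ln 2 + real m / \<beta> * ln (2 / \<epsilon>)))"
    if Q: "Q \<in> finsupp_prob" and \<epsilon>: "0 < \<epsilon>" "\<epsilon> \<le> \<delta>" for Q \<epsilon>
  proof -
    define x where "x = \<epsilon> powr (1 / \<beta>)"
    obtain k where k: "covering_number (\<epsilon> * L2_norm Q \<xi>) F Q = enat k"
      and "real k \<le> (1 + 2 / x) ^ m"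
      using cover[OF Q \<epsilon>(1)] unfolding x_def by blast
    have x: "0 < x" "x \<le> 1"
      using \<epsilon> \<open>\<delta> \<le> 1 / 2\<close> \<open>0 < \<beta>\<close> by (auto simp: x_def intro!: powr_le1)
    \<comment> \<open>Since x \<le> 1, the base is at most 3/x. Relaxing 3 to 8 = 2^3 produces the
      3m ln 2 of the target; the remaining ln 2 is the factor 2 inside
      \<open>sqrt_ln_twice\<close>.\<close>
    have "real k \<le> (8 / x) ^ m"
    proof (rule order_trans[OF \<open>real k \<le> (1 + 2 / x) ^ m\<close>])
      show "(1 + 2 / x) ^ m \<le> (8 / x) ^ m"
        using x by (intro power_mono) (auto simp: field_simps)
    qed
    moreover have "1 \<le> (8 / x) ^ m" using x by (intro one_le_power) (simp add: field_simps)
    ultimately have "sqrt_ln_twice (enat k) \<le> ennreal (sqrt (ln (2 * (8 / x) ^ m)))"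
      by (rule sqrt_ln_twice_le)
    also have "ln (2 * (8 / x) ^ m) = ln 2 + real m * (ln (2 ^ 3) - ln x)"
      using x by (simp add: ln_mult ln_realpow ln_div)
    also have "\<dots> = (3 * real m + 1) * ln 2 - real m / \<beta> * ln \<epsilon>"
      using \<epsilon> by (subst ln_realpow) (simp_all add: x_def ln_powr algebra_simps)
    \<comment> \<open>Replacing -ln \<epsilon> by ln (2/\<epsilon>) adds a nonnegative (m/\<beta>)
      ln 2. It makes the logarithm exceed 1 up to \<epsilon> = 1/2, as the integral estimate needs;
      ln (1/\<epsilon>) would not.\<close>
    also have "ennreal (sqrt ((3 * real m + 1) * ln 2 - real m / \<beta> * ln \<epsilon>))
        \<le> ennreal (sqrt ((3 * real m + 1) * ln 2 + real m / \<beta> * ln (2 / \<epsilon>)))"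
      using \<epsilon> \<open>0 < \<beta>\<close>
      by (intro ennreal_leI real_sqrt_le_mono) (simp add: ln_div algebra_simps)
    finally show ?thesis by (simp add: k)
  qed
  then have "uniform_entropy_integral F \<xi> \<delta>
    \<le> (\<integral>\<^sup>+\<epsilon>\<in>{0<..\<delta>}. ennreal (sqrt ((3 * real m + 1) * ln 2 + real m / \<beta> * ln (2 / \<epsilon>))) \<partial>lborel)"
    unfolding uniform_entropy_integral_def
    by (intro nn_integral_mono) (auto split: split_indicator intro!: SUP_least)
  also have "\<dots> \<le> ennreal (2 * \<delta> * sqrt ((3 * real m + 1) * ln 2 + real m / \<beta> * ln (2 / \<delta>)))"
    using assms by (intro nn_integral_sqrt_ln_le) auto
  finally show ?thesis .
qed

section \<open>Requirement (A 3) from the Hoelder condition\<close>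

text \<open>Both deviations inherit a Hoelder bound in the parameter: the constant is the mean of
  \<open>C\<close> for the expectations and the sum of the \<open>C (z j)\<close> for a sample. As
  the hypothesis on \<open>G\<close> holds at every point, no sample has to be excluded.\<close>

lemma requirement_A3_if_hoelder:
  fixes \<Theta> :: "'a::{metric_space, second_countable_topology} set"
    and G :: "'a \<Rightarrow> 'b \<Rightarrow> real"
  assumes Z: "Z 1 \<in> measurable M PZ" "distr M PZ (Z 1) = PZ" and "\<Theta> \<noteq> {}"
    and G: "\<And>\<theta>. \<theta> \<in> \<Theta> \<Longrightarrow> integrable PZ (G \<theta>)"
    and C: "integrable PZ C" "\<And>z. 0 \<le> C z" and "0 < \<beta>"
    and hoelder: "\<And>z \<theta> \<theta>'. \<theta> \<in> \<Theta> \<Longrightarrow> \<theta>' \<in> \<Theta> \<Longrightarrow>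
      \<bar>G \<theta> z - G \<theta>' z\<bar> \<le> C z * dist \<theta> \<theta>' powr \<beta>"
  shows "requirement_A3 M Z PZ \<Theta> G"
proof -
  obtain T where T: "countable T" "T \<subseteq> \<Theta>" "\<Theta> \<subseteq> closure T"
    by (rule separable[of \<Theta>])
  have "T \<noteq> {}" using T \<open>\<Theta> \<noteq> {}\<close> by auto
  have E: "(\<integral>\<omega>. G \<theta> (Z 1 \<omega>) \<partial>M) = (\<integral>z. G \<theta> z \<partial>PZ)" if "\<theta> \<in> \<Theta>" for \<theta>
    using integral_distr[OF Z(1), of "G \<theta>"] G[OF that] unfolding Z(2) by simp
  have mean: "(INF \<theta>'\<in>T. \<bar>(\<integral>\<omega>. G \<theta>' (Z 1 \<omega>) \<partial>M) - (\<integral>\<omega>. G \<theta> (Z 1 \<omega>) \<partial>M)\<bar>) = 0"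
    if \<theta>: "\<theta> \<in> \<Theta>" for \<theta>
  proof (rule INF_eq_0_if_hoelder)
    show "0 \<le> (\<integral>z. C z \<partial>PZ)" using C by simp
    fix t assume "t \<in> T"
    then have t: "t \<in> \<Theta>" using T by auto
    have "\<bar>(\<integral>\<omega>. G t (Z 1 \<omega>) \<partial>M) - (\<integral>\<omega>. G \<theta> (Z 1 \<omega>) \<partial>M)\<bar> = \<bar>\<integral>z. G t z - G \<theta> z \<partial>PZ\<bar>"
      unfolding E[OF t] E[OF \<theta>] using G[OF t] G[OF \<theta>] by simp
    also have "\<dots> \<le> (\<integral>z. \<bar>G t z - G \<theta> z\<bar> \<partial>PZ)" by (rule integral_abs_bound)
    also have "\<dots> \<le> (\<integral>z. C z * dist \<theta> t powr \<beta> \<partial>PZ)"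
      using hoelder[OF t \<theta>] G t \<theta> C by (intro integral_mono) (auto simp: dist_commute)
    finally show "\<bar>(\<integral>\<omega>. G t (Z 1 \<omega>) \<partial>M) - (\<integral>\<omega>. G \<theta> (Z 1 \<omega>) \<partial>M)\<bar>
        \<le> (\<integral>z. C z \<partial>PZ) * dist \<theta> t powr \<beta>" by simp
  qed (use T \<theta> \<open>0 < \<beta>\<close> in auto)
  have sample: "(INF \<theta>'\<in>T. Max ((\<lambda>j. \<bar>G \<theta> (z j) - G \<theta>' (z j)\<bar>) ` {1..n})) = 0"
    if \<theta>: "\<theta> \<in> \<Theta>" and "1 \<le> n" for \<theta> n and z :: "nat \<Rightarrow> 'b"
  proof (rule INF_eq_0_if_hoelder)
    \<comment> \<open>The sum dominates each single \<open>C (z j)\<close>, hence serves as one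
      constant for the whole maximum.\<close>
    show "0 \<le> (\<Sum>j\<in>{1..n}. C (z j))" using C by (simp add: sum_nonneg)
    fix t assume "t \<in> T"
    then have t: "t \<in> \<Theta>" using T by auto
    show "0 \<le> Max ((\<lambda>j. \<bar>G \<theta> (z j) - G t (z j)\<bar>) ` {1..n})"
      using \<open>1 \<le> n\<close> by (subst Max_ge_iff) auto
    show "Max ((\<lambda>j. \<bar>G \<theta> (z j) - G t (z j)\<bar>) ` {1..n})
        \<le> (\<Sum>j\<in>{1..n}. C (z j)) * dist \<theta> t powr \<beta>"
    proof (subst Max_le_iff)
      have "\<bar>G \<theta> (z j) - G t (z j)\<bar> \<le> (\<Sum>j\<in>{1..n}. C (z j)) * dist \<theta> t powr \<beta>"
        if "j \<in> {1..n}" for j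
      proof (rule order_trans[OF hoelder[OF \<theta> t]])
        show "C (z j) * dist \<theta> t powr \<beta> \<le> (\<Sum>j\<in>{1..n}. C (z j)) * dist \<theta> t powr \<beta>"
          using that C by (intro mult_right_mono member_le_sum) auto
      qed
      then show "\<forall>a\<in>(\<lambda>j. \<bar>G \<theta> (z j) - G t (z j)\<bar>) ` {1..n}.
          a \<le> (\<Sum>j\<in>{1..n}. C (z j)) * dist \<theta> t powr \<beta>" by blast
    qed (use \<open>1 \<le> n\<close> in auto)
  qed (use T \<theta> \<open>0 < \<beta>\<close> in auto)
  show ?thesis
    unfolding requirement_A3_def
    using T \<open>T \<noteq> {}\<close> mean sample by (intro exI[of _ T] exI[of _ "\<lambda>_. {}"]) auto
qed

section \<open>Integrability, envelope and entropy bounds for the class of all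
  \<open>G \<theta>\<close>\<close>

theorem proposition2p6:
  fixes M :: "'w measure"
    and Z :: "nat \<Rightarrow> 'w \<Rightarrow> real ^ 'd"
    and PZ :: "(real ^ 'd) measure"
    and \<Theta> :: "(real ^ 'm) set"
    and G :: "real ^ 'm \<Rightarrow> real ^ 'd \<Rightarrow> real"
    and \<beta> :: real
    and C :: "real ^ 'd \<Rightarrow> real"
  assumes "prob_space M" and "complete_measure M" and "atomless M"
    and "prob_space.indep_vars M (\<lambda>_. borel) Z {1..}"
    and "\<And>j. j \<ge> 1 \<Longrightarrow> distr M borel (Z j) = PZ"
    and "\<Theta> \<noteq> {}" and "compact \<Theta>"
    and "\<And>\<theta>. \<theta> \<in> \<Theta> \<Longrightarrow> G \<theta> \<in> borel_measurable borel"
    and "condition_H PZ \<Theta> G \<beta> C"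
  shows "((\<exists>\<zeta>. integrable PZ \<zeta> \<and> (\<forall>z. 0 < \<zeta> z) \<and>
            (\<forall>z. (SUP \<theta>\<in>\<Theta>. ereal \<bar>G \<theta> z\<bar>) \<le> ereal (\<zeta> z)))
          \<longrightarrow> requirement_A3 M Z PZ \<Theta> G) \<and>
    (\<forall>\<theta>\<^sub>0\<in>\<Theta>. diameter \<Theta> > 0 \<and> square_integrable PZ (G \<theta>\<^sub>0) \<longrightarrow>
      (let \<xi> = (\<lambda>z. C z * diameter \<Theta> powr \<beta> + \<bar>G \<theta>\<^sub>0 z\<bar>) in
        square_integrable PZ \<xi> \<and>
        positive_envelope (G ` \<Theta>) \<xi> \<and>
        (\<forall>\<epsilon>>0. (SUP Q\<in>finsupp_prob. ereal_of_enat (covering_number (\<epsilon> * L2_norm Q \<xi>) (G ` \<Theta>) Q))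
            \<le> ereal ((8 + \<epsilon> powr (1 / \<beta>)) ^ CARD('m) / \<epsilon> powr (real CARD('m) / \<beta>))) \<and>
        (\<forall>\<delta>. 0 < \<delta> \<and> \<delta> \<le> 1 / 2 \<longrightarrow>
          uniform_entropy_integral (G ` \<Theta>) \<xi> \<delta>
            \<le> ennreal (2 * \<delta> * sqrt ((3 * real CARD('m) + 1) * ln 2
                + real CARD('m) / \<beta> * ln (2 / \<delta>))))))"
proof -
  interpret prob_space M by fact
  have Z: "Z 1 \<in> borel_measurable M"
    using assms(4) by (auto simp: indep_vars_def)
  have PZ: "distr M borel (Z 1) = PZ" using assms(5) by simp
  then have sets_PZ[measurable_cong]: "sets PZ = sets borel" by auto
  have Z_PZ: "Z 1 \<in> measurable M PZ" "distr M PZ (Z 1) = PZ"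
    using Z PZ sets_PZ by (auto cong: measurable_cong_sets distr_cong)
  interpret PZ: prob_space PZ
    using prob_space_distr[OF Z] unfolding PZ .
  have H: "0 < \<beta>" "square_integrable PZ C" "\<And>z. 0 < C z"
    and hoelder: "\<And>z \<theta> \<theta>'. \<theta> \<in> \<Theta> \<Longrightarrow> \<theta>' \<in> \<Theta> \<Longrightarrow>
      \<bar>G \<theta> z - G \<theta>' z\<bar> \<le> C z * dist \<theta> \<theta>' powr \<beta>"
    using assms(9) by (auto simp: condition_H_def)
  have C: "C \<in> borel_measurable borel" "integrable PZ (\<lambda>z. (C z)\<^sup>2)"
    using H(2) sets_PZ by (auto simp: square_integrable_def cong: measurable_cong_sets)
  have C_nonneg: "0 \<le> C z" for z using H(3)[of z] by simp
  have C_int: "integrable PZ C"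
    using H(2) by (auto simp: square_integrable_def intro: PZ.square_integrable_imp_integrable)
  have G_PZ: "G \<theta> \<in> borel_measurable PZ" if "\<theta> \<in> \<Theta>" for \<theta>
    using assms(8)[OF that] sets_PZ by (simp cong: measurable_cong_sets)
  have bdd: "bounded \<Theta>" using \<open>compact \<Theta>\<close> by (rule compact_imp_bounded)
  have i: "requirement_A3 M Z PZ \<Theta> G"
    if \<zeta>: "integrable PZ \<zeta>" and env: "\<And>z. (SUP \<theta>\<in>\<Theta>. ereal \<bar>G \<theta> z\<bar>) \<le> ereal (\<zeta> z)" for \<zeta>
  \<comment> \<open>The envelope \<zeta> enters through the integrability of each
    \<open>G \<theta>\<close>; the constant \<open>C\<close> is integrable because it is square
    integrable under a probability measure.\<close>
  proof (rule requirement_A3_if_hoelder[where C = C and \<beta> = \<beta>])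
    fix \<theta> assume \<theta>: "\<theta> \<in> \<Theta>"
    have "\<bar>G \<theta> z\<bar> \<le> \<zeta> z" for z
      using env[of z] \<theta> by (simp add: SUP_le_iff)
    then show "integrable PZ (G \<theta>)"
      by (intro Bochner_Integration.integrable_bound[OF \<zeta> G_PZ[OF \<theta>]] AE_I2)
        (metis abs_ge_self order_trans real_norm_def)
  qed (use Z_PZ \<open>\<Theta> \<noteq> {}\<close> C_int C_nonneg H(1) hoelder in auto)
  have ii: "square_integrable PZ \<xi> \<and> positive_envelope (G ` \<Theta>) \<xi> \<and>
      (\<forall>\<epsilon>>0. (SUP Q\<in>finsupp_prob. ereal_of_enat (covering_number (\<epsilon> * L2_norm Q \<xi>) (G ` \<Theta>) Q))
        \<le> ereal ((8 + \<epsilon> powr (1 / \<beta>)) ^ CARD('m) / \<epsilon> powr (real CARD('m) / \<beta>))) \<and>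
      (\<forall>\<delta>. 0 < \<delta> \<and> \<delta> \<le> 1 / 2 \<longrightarrow> uniform_entropy_integral (G ` \<Theta>) \<xi> \<delta>
        \<le> ennreal (2 * \<delta> * sqrt ((3 * real CARD('m) + 1) * ln 2 + real CARD('m) / \<beta> * ln (2 / \<delta>))))"
    if \<theta>\<^sub>0: "\<theta>\<^sub>0 \<in> \<Theta>" and pos: "0 < diameter \<Theta>" and sq: "square_integrable PZ (G \<theta>\<^sub>0)"
      and \<xi>: "\<xi> = (\<lambda>z. C z * diameter \<Theta> powr \<beta> + \<bar>G \<theta>\<^sub>0 z\<bar>)" for \<theta>\<^sub>0 \<xi>
  proof -
    define D where "D = diameter \<Theta> powr \<beta>"
    have "0 < D" using pos by (simp add: D_def)
    have \<xi>': "\<xi> z = C z * D + \<bar>G \<theta>\<^sub>0 z\<bar>" for z by (simp add: \<xi> D_def)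
    have meas: "\<xi> \<in> borel_measurable borel"
      unfolding \<xi> using C(1) assms(8)[OF \<theta>\<^sub>0] by measurable
    have "square_integrable PZ \<xi>"
    proof -
      have "integrable PZ (\<lambda>z. (\<xi> z)\<^sup>2)"
      proof (rule Bochner_Integration.integrable_bound)
        show "integrable PZ (\<lambda>z. 2 * D\<^sup>2 * (C z)\<^sup>2 + 2 * (G \<theta>\<^sub>0 z)\<^sup>2)"
          using C(2) sq by (auto simp: square_integrable_def)
        have "(\<xi> z)\<^sup>2 \<le> 2 * D\<^sup>2 * (C z)\<^sup>2 + 2 * (G \<theta>\<^sub>0 z)\<^sup>2" for z
        proof -
          \<comment> \<open>This is (a + b)^2 \<le> 2a^2 + 2b^2 in disguise.\<close>
          have "0 \<le> (C z * D - \<bar>G \<theta>\<^sub>0 z\<bar>)\<^sup>2" by simp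
          then show ?thesis by (simp add: \<xi>' power2_sum power2_diff power_mult_distrib mult_ac)
        qed
        then show "AE z in PZ. norm ((\<xi> z)\<^sup>2) \<le> norm (2 * D\<^sup>2 * (C z)\<^sup>2 + 2 * (G \<theta>\<^sub>0 z)\<^sup>2)"
          by (intro AE_I2) (simp add: order_trans[OF _ abs_ge_self])
      qed (use meas in measurable)
      then show ?thesis using meas sets_PZ by (simp add: square_integrable_def cong: measurable_cong_sets)
    qed
    moreover have "positive_envelope (G ` \<Theta>) \<xi>"
    proof -
      \<comment> \<open>Compare with \<open>G \<theta>\<^sub>0\<close>: no parameter is farther than
        the diameter from \<open>\<theta>\<^sub>0\<close>, so the difference is at most
        \<open>C z * D\<close>.\<close>
      have "\<bar>G \<theta> z\<bar> \<le> \<xi> z" if "\<theta> \<in> \<Theta>" for \<theta> z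
      proof -
        have "dist \<theta> \<theta>\<^sub>0 powr \<beta> \<le> D"
          unfolding D_def using H(1) diameter_bounded_bound[OF bdd that \<theta>\<^sub>0] by (intro powr_mono2) auto
        then have "C z * dist \<theta> \<theta>\<^sub>0 powr \<beta> \<le> C z * D"
          using C_nonneg by (rule mult_left_mono)
        then show ?thesis using hoelder[OF that \<theta>\<^sub>0, of z] by (simp add: \<xi>')
      qed
      moreover have "0 < \<xi> z" for z
        using H(3)[of z] \<open>0 < D\<close> by (simp add: \<xi>' add_pos_nonneg)
      ultimately show ?thesis
        using meas by (auto simp: positive_envelope_def intro!: SUP_least)
    qed
    \<comment> \<open>This single estimate feeds both the uniform covering bound and the entropy
      integral. Its lower bound on \<xi> holds because
      \<bar>\<open>G \<theta>\<^sub>0 z\<close>\<bar> \<ge> 0.\<close>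
    moreover have cover: "\<exists>k. covering_number (\<epsilon> * L2_norm Q \<xi>) (G ` \<Theta>) Q = enat k \<and>
        real k \<le> (1 + 2 / \<epsilon> powr (1 / \<beta>)) ^ CARD('m)"
      if Q: "Q \<in> finsupp_prob" and \<epsilon>: "0 < \<epsilon>" for Q \<epsilon>
      using hoelder_covering_number[OF Q bdd \<open>\<Theta> \<noteq> {}\<close> pos assms(8) meas _ C_nonneg hoelder H(1) \<epsilon>]
      by (auto simp: \<xi>)
    have "ereal_of_enat (covering_number (\<epsilon> * L2_norm Q \<xi>) (G ` \<Theta>) Q)
        \<le> ereal ((8 + \<epsilon> powr (1 / \<beta>)) ^ CARD('m) / \<epsilon> powr (real CARD('m) / \<beta>))"
      if Q: "Q \<in> finsupp_prob" and \<epsilon>: "0 < \<epsilon>" for Q \<epsilon>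
    proof -
      define x where "x = \<epsilon> powr (1 / \<beta>)"
      have "0 < x" using \<epsilon> by (simp add: x_def)
      obtain k where k: "covering_number (\<epsilon> * L2_norm Q \<xi>) (G ` \<Theta>) Q = enat k"
        and "real k \<le> (1 + 2 / x) ^ CARD('m)"
        using cover[OF Q \<epsilon>] unfolding x_def by blast
      note \<open>real k \<le> (1 + 2 / x) ^ CARD('m)\<close>
      also have "(1 + 2 / x) ^ CARD('m) \<le> ((8 + x) / x) ^ CARD('m)"
        using \<open>0 < x\<close> by (intro power_mono) (auto simp: field_simps)
      also have "\<dots> = (8 + x) ^ CARD('m) / x ^ CARD('m)" by (rule power_divide)
      also have "x ^ CARD('m) = \<epsilon> powr (real CARD('m) / \<beta>)"
        using \<open>0 < x\<close> by (simp add: powr_realpow[symmetric]) (simp add: x_def powr_powr)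
      finally show ?thesis by (simp add: k x_def)
    qed
    ultimately show ?thesis
      using uniform_entropy_integral_le[OF H(1) zero_less_card_finite cover]
      by (auto intro!: SUP_least)
  qed
  show ?thesis
    using i ii by (auto simp: Let_def)
qed

end
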